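(* Let $\lambda\in(0,1]$, let $p$ be a price sequence, and let $T,\widehat T\ge1$ be integers. Let $A$ be the $\lambda$-parameterized algorithm with predictions for ski rental with known varying prices described in the context. Its competitive ratio $c_A(p,T;\widehat T)$ on input $(p,T)$ with prediction $\widehat T$ satisfies $$c_A(p,T;\widehat T)\le \lambda-1+\frac1\lambda\,c_{OPT}(p).$$ Moreover, if $\widehat T=T$ (and $p$ is not in case (a)), then $$c_A(p,T;T)\le\max\Bigl(\frac{P_{r_2}}{M_*(p)},\frac{P_{r_3}}{r_3}\Bigr)\ \text{ if } r_3\le M_*(p),\qquad c_A(p,T;T)\le\frac{P_{r_2}}{M_*(p)}\ \text{ otherwise.}$$
   Context: Fix an integer $B\ge2$. A price sequence $p=(p_i)_{i\ge1}$ consists of integers $0\le p_i\le B$ and is truncated at the first $i$ with $p_i=0$; so $p$ is either infinite with all entries $\ge1$, or finite, ending with its only zero entry. All quantities range only over indices for which $p_i$ is defined. Day $i$ is free if $p_i=0$ and a bargain day if $p_i=1$. Put $P_i=i-1+p_i$, $M_*(p)=\min\{P_i:i\ge1\}$, $M_t(p)=\min\{P_i:1\le i\le t\}$, $Q_t=\min\{P_i:i\ge t\}$, $OPT_t=OPT_t(p)=\min(\{t\}\cup\{P_i:1\le i\le t\})$. The agent knows $p$, is active for $T\ge1$ days ($T$ unknown), and has an integer prediction $\widehat T\ge1$ of $T$. Renting costs $1$ per day. An algorithm that buys on day $r$ has cost $T$ if $T<r$ and $P_r$ if $T\ge r$. The competitive ratio $c_A(p,T;\widehat T)$ is the cost of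 $A$ divided by $OPT_T$ (with $0/0:=1$, relevant only when $p_1=0$). Case (a): day $M_*(p)+1$ is free or day $M_*(p)$ is a bargain day. Set $c_{OPT}(p)=1$ in case (a), and otherwise $$c_{OPT}(p)=\min\Bigl(\Bigl\{\tfrac{P_r}{r}:1\le r\le M_*(p)\Bigr\}\cup\Bigl\{\tfrac{Q_{M_*(p)}}{M_*(p)}\Bigr\}\Bigr).$$ When not in case (a), let $r_0$ be the largest index $r$ with $P_r=M_*(p)$, and let $r_1$ be the smallest index $r$ attaining the minimum in $\{P_r/OPT_r:1\le r\le M_*(p)\}\cup\{P_r/M_*(p):r\ge M_*(p),P_r=Q_{M_*(p)}\}$. Algorithm $A$ (parameter $\lambda$). In case (a): rent until the first day $d$ that is either the bargain day $M_*(p)$ or the free day $M_*(p)+1$, and acquire the resource on day $d$ at price $p_d$. Otherwise: - let $s=\lceil(1-\lambda)(r_0-1)+\lambda r_1\rceil$ and let $r_2$ be the first day $r\ge s$ with $P_r-\lambda OPT_r=\min\{P_t-\lambda OPT_t:t\ge s\}$; if $P_{r_2}>P_{r_1}$, redefine $r_2:=r_1$; - let $r_3$ be a day satisfying $\frac{P_{r_3}}{OPT_{r_3}}\le\lambda-1+\frac1\lambda c_{OPT}(p)$ and minimizing $P_{r}/r$ among all days $r$ satisfying this constraint; - if $\widehat T\ge M_{\widehat T}(p)$, buy on day $r_2$ (not buying at all if $r_2>T$); otherwise buy on day $r_3$ (not buying at all if $r_3>T$). *)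

theory Defs
  imports Complex_Main
begin

text \<open>
  A price sequence is a function on the days \<open>1, 2, \<dots>\<close>; the argument \<open>0\<close> is never used.
  Truncation at the first zero price is expressed by \<open>days p\<close>, the set of indices for which the
  price is defined: it is \<open>{1, 2, \<dots>}\<close> if no price is zero, and \<open>{1, \<dots>, n}\<close> if \<open>n\<close> is the first
  day with price zero. Values of \<open>p\<close> outside \<open>days p\<close> are irrelevant to everything below.
\<close>

definition days :: "(nat \<Rightarrow> nat) \<Rightarrow> nat set" where
  "days p = {i. 1 \<le> i \<and> (\<forall>j. 1 \<le> j \<and> j < i \<longrightarrow> p j \<noteq> 0)}"

definition price_seq :: "nat \<Rightarrow> (nat \<Rightarrow> nat) \<Rightarrow> bool" where
  "price_seq B p \<longleftrightarrow> (\<forall>i\<in>days p. p i \<le> B)"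

definition free_day :: "(nat \<Rightarrow> nat) \<Rightarrow> nat \<Rightarrow> bool" where
  "free_day p i \<longleftrightarrow> i \<in> days p \<and> p i = 0"

definition bargain_day :: "(nat \<Rightarrow> nat) \<Rightarrow> nat \<Rightarrow> bool" where
  "bargain_day p i \<longleftrightarrow> i \<in> days p \<and> p i = 1"

text \<open>\<open>P_cost p i\<close>, \<open>M_star p\<close>, \<open>M_upto p t\<close>, \<open>Q_from p t\<close> and \<open>OPT p t\<close> are
  \<open>P\<^sub>i\<close>, \<open>M\<^sub>*(p)\<close>, \<open>M\<^sub>t(p)\<close>, \<open>Q\<^sub>t\<close> and \<open>OPT\<^sub>t(p)\<close>. \<open>Inf\<close> of a nonempty set of naturals is its
  least element.\<close>

definition P_cost :: "(nat \<Rightarrow> nat) \<Rightarrow> nat \<Rightarrow> nat" where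
  "P_cost p i = i - 1 + p i"

definition M_star :: "(nat \<Rightarrow> nat) \<Rightarrow> nat" where
  "M_star p = Inf (P_cost p ` days p)"

definition M_upto :: "(nat \<Rightarrow> nat) \<Rightarrow> nat \<Rightarrow> nat" where
  "M_upto p t = Min (P_cost p ` {i \<in> days p. i \<le> t})"

definition Q_from :: "(nat \<Rightarrow> nat) \<Rightarrow> nat \<Rightarrow> nat" where
  "Q_from p t = Inf (P_cost p ` {i \<in> days p. t \<le> i})"

definition OPT :: "(nat \<Rightarrow> nat) \<Rightarrow> nat \<Rightarrow> nat" where
  "OPT p t = Min ({t} \<union> P_cost p ` {i \<in> days p. i \<le> t})"

definition case_a :: "(nat \<Rightarrow> nat) \<Rightarrow> bool" where
  "case_a p \<longleftrightarrow> free_day p (M_star p + 1) \<or> bargain_day p (M_star p)"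

definition c_OPT :: "(nat \<Rightarrow> nat) \<Rightarrow> real" where
  "c_OPT p =
    (if case_a p then 1
     else Min ({real (P_cost p r) / real r | r. r \<in> days p \<and> r \<le> M_star p}
               \<union> {real (Q_from p (M_star p)) / real (M_star p)}))"

definition alg_cost :: "(nat \<Rightarrow> nat) \<Rightarrow> nat \<Rightarrow> nat \<Rightarrow> nat" where
  "alg_cost p r T = (if T < r then T else P_cost p r)"

text \<open>Competitive ratio, for \<open>T\<close> active days, of the algorithm that buys on day \<open>r\<close>.
  \<open>OPT p T = 0\<close> means that day \<open>1\<close> is free, and then buying on day \<open>1\<close>, the only day, costs \<open>0\<close>;
  so HOL's convention \<open>x / 0 = 0\<close> is not invoked for a positive cost.\<close>

definition comp_ratio :: "(nat \<Rightarrow> nat) \<Rightarrow> nat \<Rightarrow> nat \<Rightarrow> real" where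
  "comp_ratio p r T =
    (if alg_cost p r T = 0 \<and> OPT p T = 0 then 1
     else real (alg_cost p r T) / real (OPT p T))"

definition r0 :: "(nat \<Rightarrow> nat) \<Rightarrow> nat" where
  "r0 p = Max {r \<in> days p. P_cost p r = M_star p}"

definition r1_min :: "(nat \<Rightarrow> nat) \<Rightarrow> real" where
  "r1_min p =
    Min ({real (P_cost p r) / real (OPT p r) | r. r \<in> days p \<and> r \<le> M_star p}
         \<union> {real (P_cost p r) / real (M_star p) | r.
               r \<in> days p \<and> M_star p \<le> r \<and> P_cost p r = Q_from p (M_star p)})"

definition r1 :: "(nat \<Rightarrow> nat) \<Rightarrow> nat" where
  "r1 p = (LEAST r. r \<in> days p \<and>
     (r \<le> M_star p \<and> real (P_cost p r) / real (OPT p r) = r1_min p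
      \<or> M_star p \<le> r \<and> P_cost p r = Q_from p (M_star p)
          \<and> real (P_cost p r) / real (M_star p) = r1_min p))"

definition s_day :: "(nat \<Rightarrow> nat) \<Rightarrow> real \<Rightarrow> nat" where
  "s_day p lam = nat \<lceil>(1 - lam) * (real (r0 p) - 1) + lam * real (r1 p)\<rceil>"

definition r2_first :: "(nat \<Rightarrow> nat) \<Rightarrow> real \<Rightarrow> nat" where
  "r2_first p lam = (LEAST r.
     is_arg_min (\<lambda>t. real (P_cost p t) - lam * real (OPT p t))
       (\<lambda>t. t \<in> days p \<and> s_day p lam \<le> t) r)"

definition r2 :: "(nat \<Rightarrow> nat) \<Rightarrow> real \<Rightarrow> nat" where
  "r2 p lam =
    (if P_cost p (r2_first p lam) > P_cost p (r1 p) then r1 p else r2_first p lam)"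

text \<open>The day \<open>r\<^sub>3\<close> need not be unique: \<open>is_r3\<close> says that \<open>r\<close> is an admissible choice.\<close>

definition is_r3 :: "(nat \<Rightarrow> nat) \<Rightarrow> real \<Rightarrow> nat \<Rightarrow> bool" where
  "is_r3 p lam r \<longleftrightarrow>
    is_arg_min (\<lambda>t. real (P_cost p t) / real t)
      (\<lambda>t. t \<in> days p \<and>
         real (P_cost p t) / real (OPT p t) \<le> lam - 1 + 1 / lam * c_OPT p) r"

text \<open>The day on which the algorithm buys if it is still active, given the choice \<open>r3\<close> and the
  prediction \<open>That\<close>. It does not depend on \<open>T\<close>.\<close>

definition buy_day :: "(nat \<Rightarrow> nat) \<Rightarrow> real \<Rightarrow> nat \<Rightarrow> nat \<Rightarrow> nat" where
  "buy_day p lam r3 That =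
    (if case_a p then
       (LEAST d. d = M_star p \<and> bargain_day p d \<or> d = M_star p + 1 \<and> free_day p d)
     else if M_upto p That \<le> That then r2 p lam
     else r3)"

definition c_A :: "(nat \<Rightarrow> nat) \<Rightarrow> real \<Rightarrow> nat \<Rightarrow> nat \<Rightarrow> nat \<Rightarrow> real" where
  "c_A p lam r3 T That = comp_ratio p (buy_day p lam r3 That) T"


text \<open>If \<open>case_a p\<close> fails, an admissible choice of \<open>r\<^sub>3\<close> always exists.\<close>

lemma one_in_days: "1 \<in> days p"
  by (auto simp: days_def)

lemma M_star_le: "i \<in> days p \<Longrightarrow> M_star p \<le> P_cost p i"
  unfolding M_star_def by (auto intro: wellorder_Inf_le1)

lemma min_le_OPT: "min r (M_star p) \<le> OPT p r"
proof -
  have "OPT p r \<in> {r} \<union> P_cost p ` {i \<in> days p. i \<le> r}"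
    unfolding OPT_def by (rule Min_in) auto
  then show ?thesis by (auto simp: min.coboundedI2 M_star_le)
qed

lemma M_star_in_days:
  assumes "M_star p \<ge> 1"
  shows "M_star p \<in> days p"
proof (rule ccontr)
  assume "M_star p \<notin> days p"
  then obtain j where j: "1 \<le> j" "j < M_star p" "p j = 0"
    using assms by (auto simp: days_def)
  define k where "k = (LEAST k. 1 \<le> k \<and> p k = 0)"
  have k: "1 \<le> k \<and> p k = 0" unfolding k_def by (rule LeastI[of "\<lambda>k. 1 \<le> k \<and> p k = 0" j]) (use j in simp)
  have "k \<le> j" unfolding k_def by (rule Least_le) (use j in simp)
  have "p i \<noteq> 0" if "1 \<le> i" "i < k" for i
    using not_less_Least[OF that(2)[unfolded k_def]] that(1) by simp
  then have "k \<in> days p" using k by (simp add: days_def)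
  from M_star_le[OF this] show False using k j \<open>k \<le> j\<close> by (simp add: P_cost_def)
qed

lemma M_star_pos:
  assumes "\<not> case_a p"
  shows "M_star p \<ge> 1"
proof (rule ccontr)
  assume "\<not> M_star p \<ge> 1"
  then have 0: "M_star p = 0" by simp
  have "M_star p \<in> P_cost p ` days p"
    unfolding M_star_def using one_in_days by (intro wellorder_InfI) blast
  then obtain i where i: "i \<in> days p" "P_cost p i = 0" using 0 by auto
  then have "i = 1" "p i = 0" by (auto simp: P_cost_def days_def)
  then show False using assms i 0 by (auto simp: case_a_def free_day_def)
qed

lemma ex_is_r3:
  assumes "\<not> case_a p" "0 < lam" "lam \<le> 1"
  shows "\<exists>r. is_r3 p lam r"
proof -
  define M where "M = M_star p"
  define C where "C = lam - 1 + 1 / lam * c_OPT p"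
  define S where "S = {t \<in> days p. real (P_cost p t) / real (OPT p t) \<le> C}"
  have M: "M \<ge> 1" "M \<in> days p"
    using M_star_pos[OF assms(1)] M_star_in_days by (auto simp: M_def)
  have pos: "OPT p t \<ge> 1" if "t \<in> days p" for t
    using min_le_OPT[of t p] M that by (auto simp: M_def days_def)
  let ?X = "{real (P_cost p r) / real r | r. r \<in> days p \<and> r \<le> M} \<union> {real (Q_from p M) / real M}"
  have "?X = (\<lambda>r. real (P_cost p r) / real r) ` {r \<in> days p. r \<le> M} \<union> {real (Q_from p M) / real M}"
    by auto
  then have "finite ?X" by simp
  then have cin: "c_OPT p \<in> ?X"
    using assms(1) Min_in[of ?X] by (simp add: c_OPT_def M_def)
  have "Q_from p M \<in> P_cost p ` {i \<in> days p. M \<le> i}"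
    unfolding Q_from_def using M by (intro wellorder_InfI) blast
  then obtain q where q: "q \<in> days p" "M \<le> q" "Q_from p M = P_cost p q" by auto
  have *: "\<exists>r\<in>days p. real (P_cost p r) / real (OPT p r) \<le> c_OPT p \<and> 1 \<le> c_OPT p"
    using cin
  proof
    assume "c_OPT p \<in> {real (P_cost p r) / real r | r. r \<in> days p \<and> r \<le> M}"
    then obtain r where r: "c_OPT p = real (P_cost p r) / real r" "r \<in> days p" "r \<le> M" by auto
    have "r \<ge> 1" using r by (auto simp: days_def)
    moreover have "r \<le> OPT p r" using min_le_OPT[of r p] r by (simp add: M_def)
    moreover have "r \<le> P_cost p r" using M_star_le[OF r(2)] r by (simp add: M_def)
    ultimately show ?thesis using r by (auto intro!: bexI[of _ r] divide_left_mono)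
  next
    assume "c_OPT p \<in> {real (Q_from p M) / real M}"
    then have c: "c_OPT p = real (P_cost p q) / real M" using q by simp
    moreover have "M \<le> OPT p q" using min_le_OPT[of q p] q by (simp add: M_def)
    moreover have "M \<le> P_cost p q" using M_star_le[OF q(1)] by (simp add: M_def)
    ultimately show ?thesis using M q by (auto intro!: bexI[of _ q] divide_left_mono)
  qed
  then have "1 \<le> c_OPT p" by auto
  then have "0 \<le> (1 - lam) * (c_OPT p / lam - 1)"
    using assms by (intro mult_nonneg_nonneg) (auto simp: field_simps)
  also have "\<dots> = C - c_OPT p" using assms by (simp add: C_def field_simps)
  finally have "c_OPT p \<le> C" by simp
  then have ne: "S \<noteq> {}" using * by (fastforce simp: S_def)
  have "S \<subseteq> {.. nat \<lceil>C * real (P_cost p 1)\<rceil> + 1}"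
  proof
    fix t assume t: "t \<in> S"
    then have td: "t \<in> days p" by (simp add: S_def)
    have "OPT p t \<le> P_cost p 1"
      unfolding OPT_def using td one_in_days by (intro Min_le) (auto simp: days_def)
    moreover have "real (P_cost p t) \<le> C * real (OPT p t)"
      using t pos[OF td] by (simp add: S_def field_simps)
    moreover have "C \<ge> 0" using \<open>c_OPT p \<le> C\<close> \<open>1 \<le> c_OPT p\<close> by linarith
    ultimately have "real (P_cost p t) \<le> C * real (P_cost p 1)"
      by (meson mult_left_mono of_nat_le_iff order_trans)
    moreover have "real t - 1 \<le> real (P_cost p t)" by (simp add: P_cost_def)
    ultimately have "real t \<le> C * real (P_cost p 1) + 1" by linarith
    then show "t \<in> {.. nat \<lceil>C * real (P_cost p 1)\<rceil> + 1}" by simp linarith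
  qed
  then have "finite S" by (rule finite_subset) simp
  from ex_is_arg_min_if_finite[OF this ne] show ?thesis
    by (simp add: is_r3_def S_def C_def)
qed

end

theory Submission
  imports Defs
begin

text \<open>
  Write \<open>M\<close> for \<open>M_star p\<close> and \<open>c\<close> for \<open>c_OPT p\<close>. Outside case (a), some day \<open>r \<le> M\<close> attains
  \<open>P\<^sub>r = M\<close>, so the offline optimum is \<open>OPT\<^sub>t = min t M\<close>; consequently buying on day \<open>r\<close> has ratio at
  most \<open>P\<^sub>r / OPT\<^sub>r\<close> whatever \<open>T\<close> is, and \<open>P\<^bsub>r\<^sub>1\<^esub> = c OPT\<^bsub>r\<^sub>1\<^esub>\<close>. The day \<open>r\<^sub>3\<close> then meets the
  bound by its definition. For \<open>r\<^sub>2\<close>, minimality gives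
  \<open>P\<^bsub>r\<^sub>2\<^esub> \<le> \<lambda> OPT\<^bsub>r\<^sub>2\<^esub> + (c - \<lambda>) OPT\<^bsub>r\<^sub>1\<^esub>\<close>, and \<open>r\<^sub>2 \<ge> s \<ge> \<lambda> r\<^sub>1\<close> gives
  \<open>\<lambda> OPT\<^bsub>r\<^sub>1\<^esub> \<le> OPT\<^bsub>r\<^sub>2\<^esub>\<close>.
\<close>

section \<open>Basic facts and case (a)\<close>

lemma days_ge_1: "r \<in> days p \<Longrightarrow> 1 \<le> r"
  by (simp add: days_def)

lemma OPT_le: "OPT p t \<le> t"
  unfolding OPT_def by (rule Min_le) auto

lemma M_star_attained:
  obtains r where "r \<in> days p" "P_cost p r = M_star p"
proof -
  have "M_star p \<in> P_cost p ` days p"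
    unfolding M_star_def using one_in_days by (intro wellorder_InfI) blast
  then show ?thesis using that by auto
qed

text \<open>A bargain day \<open>M\<close> and a free day \<open>M + 1\<close> both have total cost
  \<open>M\<close>, and renting before either costs at most \<open>M\<close>. So the cost is at most
  \<open>min T M\<close>, which \<open>min_le_OPT\<close> bounds by the optimum.\<close>

lemma comp_ratio_case_a:
  assumes "case_a p" "1 \<le> T"
  shows "comp_ratio p (buy_day p lam r3 That) T \<le> 1"
proof -
  define d where "d = buy_day p lam r3 That"
  have "\<exists>d. d = M_star p \<and> bargain_day p d \<or> d = M_star p + 1 \<and> free_day p d"
    using assms(1) by (auto simp: case_a_def)
  from LeastI_ex[OF this]
  have d: "d = M_star p \<and> bargain_day p d \<or> d = M_star p + 1 \<and> free_day p d"
    using assms(1) by (simp add: d_def buy_day_def)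
  then have "P_cost p d = M_star p"
    by (auto simp: P_cost_def bargain_day_def free_day_def dest: days_ge_1)
  then have "alg_cost p d T \<le> min T (M_star p)"
    using d by (auto simp: alg_cost_def)
  then have "alg_cost p d T \<le> OPT p T"
    using min_le_OPT[of T p] by linarith
  then show ?thesis
    by (auto simp: comp_ratio_def d_def[symmetric] divide_le_eq_1)
qed

section \<open>Outside case (a): the offline optimum and the ratio of a fixed buying day\<close>

context
  fixes p :: "nat \<Rightarrow> nat"
  assumes not_a: "\<not> case_a p"
begin

text \<open>A later day \<open>r\<close> with total cost \<open>M\<close> would have price zero and
  equal \<open>M + 1\<close>, the free day that case (a) covers.\<close>

lemma M_star_day_le:
  assumes "r \<in> days p" "P_cost p r = M_star p"
  shows "r \<le> M_star p"
proof (rule ccontr)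
  assume "\<not> r \<le> M_star p"
  then have "r = M_star p + 1" "p r = 0"
    using assms(2) by (auto simp: P_cost_def)
  then show False
    using not_a assms(1) by (auto simp: case_a_def free_day_def)
qed

lemma OPT_eq_min: "OPT p t = min t (M_star p)"
proof (rule antisym)
  obtain r where r: "r \<in> days p" "P_cost p r = M_star p"
    by (rule M_star_attained)
  have "OPT p t \<le> M_star p" if "M_star p \<le> t"
  proof -
    have "P_cost p r \<in> P_cost p ` {i \<in> days p. i \<le> t}"
      using r M_star_day_le[OF r] that by (intro imageI) simp
    then show ?thesis
      unfolding OPT_def r(2) by (intro Min_le) auto
  qed
  then show "OPT p t \<le> min t (M_star p)"
    using OPT_le[of p t] by (cases "M_star p \<le> t") auto
qed (rule min_le_OPT)

lemma OPT_pos: "1 \<le> t \<Longrightarrow> 1 \<le> OPT p t"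
  using M_star_pos[OF not_a] by (simp add: OPT_eq_min)

lemma OPT_le_P_cost: "r \<in> days p \<Longrightarrow> OPT p r \<le> P_cost p r"
  using M_star_le by (fastforce simp: OPT_eq_min)

lemma comp_ratio_eq:
  assumes "1 \<le> T"
  shows "comp_ratio p r T = real (alg_cost p r T) / real (OPT p T)"
  using OPT_pos[OF assms] by (simp add: comp_ratio_def)

text \<open>The worst horizon is \<open>T = r\<close>. Earlier, the ratio is 1 while
  \<open>T \<le> M\<close>, and after that the optimum is already \<open>M\<close> while the rent is
  still at most the total cost of day \<open>r\<close>. Later, the cost is fixed and the optimum
  does not decrease.\<close>

lemma comp_ratio_le:
  assumes "r \<in> days p" "1 \<le> T"
  shows "comp_ratio p r T \<le> real (P_cost p r) / real (OPT p r)"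
proof -
  have pos: "1 \<le> OPT p r" "1 \<le> OPT p T"
    using assms OPT_pos days_ge_1 by blast+
  consider "T < r" "T \<le> M_star p" | "T < r" "M_star p < T" | "r \<le> T"
    by linarith
  then show ?thesis
  proof cases
    case 1
    then show ?thesis
      using pos assms OPT_le_P_cost[OF assms(1)]
      by (simp add: comp_ratio_eq alg_cost_def OPT_eq_min[of T])
  next
    case 2
    then have "T \<le> P_cost p r" by (simp add: P_cost_def)
    then show ?thesis
      using 2 assms by (simp add: comp_ratio_eq alg_cost_def OPT_eq_min divide_right_mono)
  next
    case 3
    then have "OPT p r \<le> OPT p T" by (simp add: OPT_eq_min)
    then show ?thesis
      using 3 pos assms by (auto simp: comp_ratio_eq alg_cost_def intro!: divide_left_mono)
  qed
qed

section \<open>The optimal ratio and the days \<open>r1\<close> and \<open>r0\<close>\<close>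

lemma Q_from_attained:
  obtains q where "q \<in> days p" "M_star p \<le> q" "P_cost p q = Q_from p (M_star p)"
proof -
  have "Q_from p (M_star p) \<in> P_cost p ` {i \<in> days p. M_star p \<le> i}"
    unfolding Q_from_def using M_star_in_days[OF M_star_pos[OF not_a]]
    by (intro wellorder_InfI) blast
  then show ?thesis using that by auto
qed

text \<open>On days up to \<open>M\<close> the optimum is the day itself, and all days attaining
  \<open>Q_from p M\<close> give the same quotient, so the second set is a singleton.\<close>

lemma r1_min_eq_c_OPT: "r1_min p = c_OPT p"
proof -
  have "{real (P_cost p r) / real (OPT p r) | r. r \<in> days p \<and> r \<le> M_star p}
      = {real (P_cost p r) / real r | r. r \<in> days p \<and> r \<le> M_star p}"
    by (intro Collect_cong ex_cong1) (auto simp: OPT_eq_min min_absorb1)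
  moreover have "{real (P_cost p r) / real (M_star p) | r.
        r \<in> days p \<and> M_star p \<le> r \<and> P_cost p r = Q_from p (M_star p)}
      = {real (Q_from p (M_star p)) / real (M_star p)}"
    by (rule Q_from_attained) force
  ultimately show ?thesis
    using not_a by (simp add: r1_min_def c_OPT_def)
qed

lemma finite_c_OPT_set:
  "finite ({real (P_cost p r) / real r | r. r \<in> days p \<and> r \<le> M_star p}
           \<union> {real (Q_from p (M_star p)) / real (M_star p)})"
proof -
  have "{real (P_cost p r) / real r | r. r \<in> days p \<and> r \<le> M_star p}
      = (\<lambda>r. real (P_cost p r) / real r) ` {r \<in> days p. r \<le> M_star p}"
    by auto
  then show ?thesis by simp
qed

lemma c_OPT_le:
  assumes "r \<in> days p" "r \<le> M_star p"
  shows "c_OPT p \<le> real (P_cost p r) / real r"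
  using not_a assms finite_c_OPT_set by (auto simp: c_OPT_def intro!: Min_le)

lemma r1_spec:
  shows r1_in_days: "r1 p \<in> days p"
    and r1_ratio: "real (P_cost p (r1 p)) / real (OPT p (r1 p)) = c_OPT p"
proof -
  let ?A = "\<lambda>r. r \<in> days p \<and>
     (r \<le> M_star p \<and> real (P_cost p r) / real (OPT p r) = r1_min p
      \<or> M_star p \<le> r \<and> P_cost p r = Q_from p (M_star p)
          \<and> real (P_cost p r) / real (M_star p) = r1_min p)"
  have "c_OPT p \<in> {real (P_cost p r) / real r | r. r \<in> days p \<and> r \<le> M_star p}
           \<union> {real (Q_from p (M_star p)) / real (M_star p)}"
    using not_a Min_in[OF finite_c_OPT_set] by (simp add: c_OPT_def)
  then have "\<exists>r. ?A r"
  proof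
    assume "c_OPT p \<in> {real (P_cost p r) / real r | r. r \<in> days p \<and> r \<le> M_star p}"
    then obtain r where "r \<in> days p" "r \<le> M_star p" "c_OPT p = real (P_cost p r) / real r"
      by auto
    then show ?thesis
      by (intro exI[of _ r]) (simp add: OPT_eq_min r1_min_eq_c_OPT)
  next
    assume c: "c_OPT p \<in> {real (Q_from p (M_star p)) / real (M_star p)}"
    obtain q where "q \<in> days p" "M_star p \<le> q" "P_cost p q = Q_from p (M_star p)"
      by (rule Q_from_attained)
    with c show ?thesis
      by (intro exI[of _ q]) (simp add: r1_min_eq_c_OPT)
  qed
  from LeastI_ex[OF this] have "?A (r1 p)"
    by (simp add: r1_def)
  then show "r1 p \<in> days p" "real (P_cost p (r1 p)) / real (OPT p (r1 p)) = c_OPT p"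
    by (auto simp: r1_min_eq_c_OPT OPT_eq_min)
qed

lemma c_OPT_ge_1: "1 \<le> c_OPT p"
  using OPT_le_P_cost[OF r1_in_days] OPT_pos[OF days_ge_1[OF r1_in_days]]
  by (simp flip: r1_ratio)

lemma r0_spec: "r0 p \<in> days p \<and> P_cost p (r0 p) = M_star p"
proof -
  have "finite {r \<in> days p. P_cost p r = M_star p}"
    by (rule finite_subset[of _ "{..M_star p}"]) (auto intro: M_star_day_le)
  moreover have "{r \<in> days p. P_cost p r = M_star p} \<noteq> {}"
    by (rule M_star_attained) auto
  ultimately show ?thesis
    using Min_in Max_in unfolding r0_def by blast
qed

text \<open>If \<open>r1 < r0\<close>, day \<open>r0\<close> would reach the least total cost
  \<open>M\<close> with a larger denominator, beating the optimal ratio attained at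
  \<open>r1\<close>.\<close>

lemma r0_le_r1: "r0 p \<le> r1 p"
proof (rule ccontr)
  assume less: "\<not> r0 p \<le> r1 p"
  have r0: "r0 p \<le> M_star p" using r0_spec M_star_day_le by blast
  have pos: "1 \<le> r1 p" using r1_in_days days_ge_1 by blast
  have "c_OPT p \<le> real (M_star p) / real (r0 p)"
    using c_OPT_le[of "r0 p"] r0_spec r0 by simp
  also have "\<dots> < real (M_star p) / real (r1 p)"
    using less pos r0 by (intro divide_strict_left_mono) auto
  also have "\<dots> \<le> real (P_cost p (r1 p)) / real (r1 p)"
    using M_star_le[OF r1_in_days] by (simp add: divide_right_mono)
  also have "\<dots> = c_OPT p"
    using less r0 r1_ratio by (simp add: OPT_eq_min)
  finally show False by simp
qed

section \<open>The threshold \<open>s_day\<close>, the day \<open>r2\<close> and the bounds for the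
  algorithm\<close>

context
  fixes lam :: real
  assumes lam: "0 < lam" "lam \<le> 1"
begin

lemma c_OPT_le_bound: "c_OPT p \<le> lam - 1 + 1 / lam * c_OPT p"
proof -
  have "0 \<le> (1 - lam) * (c_OPT p / lam - 1)"
    using lam c_OPT_ge_1 by (intro mult_nonneg_nonneg) (auto simp: field_simps)
  also have "\<dots> = lam - 1 + 1 / lam * c_OPT p - c_OPT p"
    using lam by (simp add: field_simps)
  finally show ?thesis by simp
qed

lemma s_day_ge: "lam * real (r1 p) \<le> real (s_day p lam)"
proof -
  have "0 \<le> (1 - lam) * (real (r0 p) - 1)"
    using lam r0_spec days_ge_1[of "r0 p" p] by (intro mult_nonneg_nonneg) auto
  then show ?thesis
    unfolding s_day_def by linarith
qed

text \<open>A convex combination of \<open>r0 - 1\<close> and \<open>r1\<close> is at most the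
  integer \<open>r1\<close>, hence so is its ceiling. This makes \<open>r1\<close> a competitor in
  the minimization defining \<open>r2_first\<close>.\<close>

lemma s_day_le: "s_day p lam \<le> r1 p"
proof -
  have "(1 - lam) * (real (r0 p) - 1) \<le> (1 - lam) * real (r1 p)"
    using lam r0_le_r1 by (intro mult_left_mono) auto
  then have "(1 - lam) * (real (r0 p) - 1) + lam * real (r1 p) \<le> real (r1 p)"
    by (simp add: algebra_simps)
  then show ?thesis
    unfolding s_day_def by linarith
qed

text \<open>There may be infinitely many days, but total costs grow with the day while the optimum
  stays at most \<open>M\<close>. Only finitely many days do at least as well as \<open>r1\<close>,
  and a minimizer among them is a global one.\<close>

lemma r2_first_arg_min:
  "is_arg_min (\<lambda>t. real (P_cost p t) - lam * real (OPT p t))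
     (\<lambda>t. t \<in> days p \<and> s_day p lam \<le> t) (r2_first p lam)"
proof -
  let ?f = "\<lambda>t. real (P_cost p t) - lam * real (OPT p t)"
  let ?S = "{t \<in> days p. s_day p lam \<le> t \<and> ?f t \<le> ?f (r1 p)}"
  have "t \<le> P_cost p (r1 p) + M_star p + 1" if "t \<in> ?S" for t
  proof -
    have "lam * real (OPT p t) \<le> 1 * real (M_star p)"
      using lam by (intro mult_mono) (auto simp: OPT_eq_min)
    moreover have "0 \<le> lam * real (OPT p (r1 p))" using lam by simp
    moreover have "t \<le> P_cost p t + 1" by (simp add: P_cost_def)
    moreover have "?f t \<le> ?f (r1 p)" using that by simp
    ultimately show ?thesis by linarith
  qed
  then have "finite ?S"
    by (intro finite_subset[of ?S "{..P_cost p (r1 p) + M_star p + 1}"]) auto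
  moreover have "?S \<noteq> {}"
    using r1_in_days s_day_le by auto
  ultimately obtain r where "is_arg_min ?f (\<lambda>t. t \<in> ?S) r"
    using ex_is_arg_min_if_finite[of ?S ?f] by blast
  then have "is_arg_min ?f (\<lambda>t. t \<in> days p \<and> s_day p lam \<le> t) r"
    by (force simp: is_arg_min_linorder)
  then show ?thesis
    unfolding r2_first_def by (rule LeastI)
qed

lemma r2_in_days: "r2 p lam \<in> days p"
  using r2_first_arg_min r1_in_days by (auto simp: r2_def is_arg_min_def)

lemma r2_ratio_le:
  "real (P_cost p (r2 p lam)) / real (OPT p (r2 p lam)) \<le> lam - 1 + 1 / lam * c_OPT p"
proof (cases "r2 p lam = r1 p")
  case True
  then show ?thesis using r1_ratio c_OPT_le_bound by simp
next
  case False
  then have r2: "r2 p lam = r2_first p lam"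
    by (auto simp: r2_def split: if_splits)
  let ?r = "r2 p lam" and ?c = "c_OPT p"
  let ?O = "real (OPT p ?r)" and ?O1 = "real (OPT p (r1 p))"
  have min: "real (P_cost p ?r) - lam * ?O \<le> real (P_cost p (r1 p)) - lam * ?O1"
    and ge: "s_day p lam \<le> ?r"
    using r2_first_arg_min r1_in_days s_day_le by (auto simp: r2 is_arg_min_linorder)
  have pos: "0 < ?O" "0 < ?O1"
    using OPT_pos[OF days_ge_1[OF r2_in_days]] OPT_pos[OF days_ge_1[OF r1_in_days]]
    by simp_all
  have P1: "real (P_cost p (r1 p)) = ?c * ?O1"
    using r1_ratio pos by (simp add: field_simps)
  \<comment> \<open>Both arguments of the minimum \<open>min r2 M\<close> dominate
    \<open>lam * ?O1\<close>: the first through the threshold \<open>s_day\<close>, the second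
    because \<open>lam \<le> 1\<close>.\<close>
  have "lam * ?O1 \<le> lam * real (r1 p)" "lam * ?O1 \<le> lam * real (M_star p)"
    using lam by (auto simp: OPT_eq_min)
  moreover have "lam * real (M_star p) \<le> real (M_star p)"
    using lam by (simp add: mult_left_le_one_le)
  ultimately have O: "lam * ?O1 \<le> ?O"
    using s_day_ge ge by (simp add: OPT_eq_min min_def)
  have "real (P_cost p ?r) \<le> lam * ?O + (?c - lam) * ?O1"
    using min P1 by (simp add: algebra_simps)
  \<comment> \<open>The rescaling exposes \<open>lam * ?O1\<close>; its coefficient is nonnegative
    since \<open>lam \<le> 1 \<le> ?c\<close>.\<close>
  also have "\<dots> = lam * ?O + (?c - lam) / lam * (lam * ?O1)"
    using lam by simp
  also have "\<dots> \<le> lam * ?O + (?c - lam) / lam * ?O"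
    using O lam c_OPT_ge_1 by (intro add_left_mono mult_left_mono) auto
  also have "\<dots> = (lam - 1 + 1 / lam * ?c) * ?O"
    using lam by (simp add: field_simps)
  finally show ?thesis using pos by (simp add: pos_divide_le_eq)
qed

lemma comp_ratio_buy_day_le:
  assumes "is_r3 p lam r3" "1 \<le> T"
  shows "comp_ratio p (buy_day p lam r3 That) T \<le> lam - 1 + 1 / lam * c_OPT p"
proof -
  have r3: "r3 \<in> days p"
      "real (P_cost p r3) / real (OPT p r3) \<le> lam - 1 + 1 / lam * c_OPT p"
    using assms(1) by (auto simp: is_r3_def is_arg_min_def)
  show ?thesis
    using comp_ratio_le[OF r2_in_days assms(2)] r2_ratio_le comp_ratio_le[OF r3(1) assms(2)] r3(2)
      not_a
    by (auto simp: buy_day_def)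
qed

text \<open>With a correct prediction the test amounts to \<open>M \<le> T\<close>. If it holds,
  \<open>r2\<close> is used against the optimum \<open>M\<close>. Otherwise either
  \<open>T < r3\<close> and the ratio is 1, or \<open>r3 \<le> T < M\<close>, so that the optimum at
  \<open>r3\<close> is \<open>r3\<close> itself.\<close>

lemma comp_ratio_buy_day_consistent:
  assumes "r3 \<in> days p" "1 \<le> T"
  shows "comp_ratio p (buy_day p lam r3 T) T \<le> real (P_cost p (r2 p lam)) / real (M_star p)
    \<or> r3 \<le> M_star p \<and>
      comp_ratio p (buy_day p lam r3 T) T \<le> real (P_cost p r3) / real r3"
proof (cases "M_star p \<le> T")
  case True
  have "M_upto p T \<le> P_cost p (r0 p)"
    unfolding M_upto_def using r0_spec M_star_day_le[of "r0 p"] True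
    by (intro Min_le imageI) auto
  then have "buy_day p lam r3 T = r2 p lam"
    using True r0_spec not_a by (simp add: buy_day_def)
  moreover have "alg_cost p (r2 p lam) T \<le> P_cost p (r2 p lam)"
    by (auto simp: alg_cost_def P_cost_def)
  ultimately show ?thesis
    using True assms(2) by (simp add: comp_ratio_eq OPT_eq_min divide_right_mono)
next
  case False
  have "M_upto p T \<in> P_cost p ` {i \<in> days p. i \<le> T}"
    unfolding M_upto_def using one_in_days assms(2) by (intro Min_in) auto
  then have "M_star p \<le> M_upto p T"
    using M_star_le by auto
  then have buy: "buy_day p lam r3 T = r3"
    using False not_a by (simp add: buy_day_def)
  show ?thesis
  proof (cases "T < r3")
    case True
    then have "comp_ratio p r3 T = 1"
      using False assms(2) by (simp add: comp_ratio_eq alg_cost_def OPT_eq_min)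
    then show ?thesis
      using buy M_star_le[OF r2_in_days] M_star_pos[OF not_a] by simp
  next
    case ge: False
    then have "comp_ratio p r3 T \<le> real (P_cost p r3) / real r3"
      using comp_ratio_le[OF assms] False by (simp add: OPT_eq_min)
    then show ?thesis
      using buy ge False by simp
  qed
qed

end

end

theorem theorem6:
  fixes B T That r3 :: nat and p :: "nat \<Rightarrow> nat" and lam :: real
  assumes "2 \<le> B" and "price_seq B p"
    and "0 < lam" and "lam \<le> 1"
    and "1 \<le> T" and "1 \<le> That"
    and r3: "\<not> case_a p \<Longrightarrow> is_r3 p lam r3"
  shows "c_A p lam r3 T That \<le> lam - 1 + 1 / lam * c_OPT p
    \<and> (That = T \<and> \<not> case_a p \<longrightarrow>
        (if r3 \<le> M_star p
         then c_A p lam r3 T T \<le> max (real (P_cost p (r2 p lam)) / real (M_star p))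
                                     (real (P_cost p r3) / real r3)
         else c_A p lam r3 T T \<le> real (P_cost p (r2 p lam)) / real (M_star p)))"
proof (cases "case_a p")
  case True
  \<comment> \<open>With \<open>c_OPT p = 1\<close> the bound exceeds 1 by exactly this square
    divided by \<open>lam\<close>.\<close>
  have "(1 - lam) * (1 - lam) \<ge> 0" by simp
  then have "1 \<le> lam - 1 + 1 / lam"
    using assms(3) by (simp add: field_simps)
  then show ?thesis
    using True comp_ratio_case_a[OF True assms(5), of lam r3 That]
    by (simp add: c_A_def c_OPT_def)
next
  case False
  have "r3 \<in> days p"
    using r3[OF False] by (simp add: is_r3_def is_arg_min_def)
  from comp_ratio_buy_day_consistent[OF False assms(3,4) this assms(5)]
    comp_ratio_buy_day_le[OF False assms(3,4) r3[OF False] assms(5), of That]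
  show ?thesis
    by (auto simp: c_A_def le_max_iff_disj)
qed

end
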